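(* Let $T$ be a theory (a set of sentences of the language of arithmetic) such that the set $\mathcal{Pr}_T$ of Gödel numbers of sentences provable in $T$ is definable in the standard model $\omega$ (in particular, this covers the case where $T$ is recursively axiomatizable). If $T$ is sound, then $T$ is incomplete.
   Context: Fix a standard first-order language of arithmetic (with equality, constant $0$, unary function symbol $s$, binary function symbols $+,\cdot$, order $\le$ primitive or defined) and a standard Gödel numbering. Formulas and sentences are those of this language. A theory is an arbitrary set of sentences. $\omega$ is the standard model of arithmetic; "true" and "definable" mean true and definable in $\omega$ (by a formula of the language). $T$ is sound if all sentences belonging to $T$ are true in $\omega$. $T$ is incomplete if there is a sentence $\sigma$ such that $T\not\vdash\sigma$ and $T\not\vdash\neg\sigma$. $T$ is recursively axiomatizable if it has the same theorems as some theory whose set of Gödel numbers is recursive. Note that $T$ is not assumed to extend Robinson arithmetic. *)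

theory Defs
  imports Main "HOL-Library.Nat_Bijection"
begin

section \<open>The language of arithmetic\<close>

datatype tm =
    Var nat
  | Zero
  | Succ tm
  | Add tm tm
  | Mul tm tm

text \<open>The remaining connectives and the existential quantifier are the usual classical
  abbreviations in terms of negation, implication and the universal quantifier.\<close>

datatype fm =
    Eq tm tm
  | Le tm tm
  | Neg fm
  | Imp fm fm
  | All nat fm

primrec fv_tm :: "tm \<Rightarrow> nat set" where
  "fv_tm (Var i) = {i}"
| "fv_tm Zero = {}"
| "fv_tm (Succ t) = fv_tm t"
| "fv_tm (Add t u) = fv_tm t \<union> fv_tm u"
| "fv_tm (Mul t u) = fv_tm t \<union> fv_tm u"

primrec fv :: "fm \<Rightarrow> nat set" where
  "fv (Eq t u) = fv_tm t \<union> fv_tm u"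
| "fv (Le t u) = fv_tm t \<union> fv_tm u"
| "fv (Neg \<phi>) = fv \<phi>"
| "fv (Imp \<phi> \<psi>) = fv \<phi> \<union> fv \<psi>"
| "fv (All x \<phi>) = fv \<phi> - {x}"

definition sentence :: "fm \<Rightarrow> bool" where
  "sentence \<phi> \<longleftrightarrow> fv \<phi> = {}"

definition is_theory :: "fm set \<Rightarrow> bool" where
  "is_theory T \<longleftrightarrow> (\<forall>\<sigma>\<in>T. sentence \<sigma>)"


section \<open>The standard model\<close>

primrec val :: "(nat \<Rightarrow> nat) \<Rightarrow> tm \<Rightarrow> nat" where
  "val e (Var i) = e i"
| "val e Zero = 0"
| "val e (Succ t) = Suc (val e t)"
| "val e (Add t u) = val e t + val e u"
| "val e (Mul t u) = val e t * val e u"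

primrec sat :: "(nat \<Rightarrow> nat) \<Rightarrow> fm \<Rightarrow> bool" where
  "sat e (Eq t u) \<longleftrightarrow> val e t = val e u"
| "sat e (Le t u) \<longleftrightarrow> val e t \<le> val e u"
| "sat e (Neg \<phi>) \<longleftrightarrow> \<not> sat e \<phi>"
| "sat e (Imp \<phi> \<psi>) \<longleftrightarrow> (sat e \<phi> \<longrightarrow> sat e \<psi>)"
| "sat e (All x \<phi>) \<longleftrightarrow> (\<forall>n. sat (e(x := n)) \<phi>)"

definition true_in_omega :: "fm \<Rightarrow> bool" where
  "true_in_omega \<sigma> \<longleftrightarrow> (\<forall>e. sat e \<sigma>)"

definition definable :: "nat set \<Rightarrow> bool" where
  "definable A \<longleftrightarrow>
     (\<exists>\<phi> x. fv \<phi> \<subseteq> {x} \<and> (\<forall>e n. n \<in> A \<longleftrightarrow> sat (e(x := n)) \<phi>))"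

definition sound :: "fm set \<Rightarrow> bool" where
  "sound T \<longleftrightarrow> (\<forall>\<sigma>\<in>T. true_in_omega \<sigma>)"


section \<open>Provability\<close>

primrec subst_tm :: "tm \<Rightarrow> nat \<Rightarrow> tm \<Rightarrow> tm" where
  "subst_tm (Var i) x s = (if i = x then s else Var i)"
| "subst_tm Zero x s = Zero"
| "subst_tm (Succ t) x s = Succ (subst_tm t x s)"
| "subst_tm (Add t u) x s = Add (subst_tm t x s) (subst_tm u x s)"
| "subst_tm (Mul t u) x s = Mul (subst_tm t x s) (subst_tm u x s)"

text \<open>Substitution does not rename bound variables; it is only used under the side
  condition that the term is free for the variable.\<close>

primrec subst :: "fm \<Rightarrow> nat \<Rightarrow> tm \<Rightarrow> fm" where
  "subst (Eq t u) x s = Eq (subst_tm t x s) (subst_tm u x s)"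
| "subst (Le t u) x s = Le (subst_tm t x s) (subst_tm u x s)"
| "subst (Neg \<phi>) x s = Neg (subst \<phi> x s)"
| "subst (Imp \<phi> \<psi>) x s = Imp (subst \<phi> x s) (subst \<psi> x s)"
| "subst (All y \<phi>) x s = (if y = x then All y \<phi> else All y (subst \<phi> x s))"

primrec free_for :: "tm \<Rightarrow> nat \<Rightarrow> fm \<Rightarrow> bool" where
  "free_for s x (Eq t u) \<longleftrightarrow> True"
| "free_for s x (Le t u) \<longleftrightarrow> True"
| "free_for s x (Neg \<phi>) \<longleftrightarrow> free_for s x \<phi>"
| "free_for s x (Imp \<phi> \<psi>) \<longleftrightarrow> free_for s x \<phi> \<and> free_for s x \<psi>"
| "free_for s x (All y \<phi>) \<longleftrightarrow>
     x \<notin> fv (All y \<phi>) \<or> (y \<notin> fv_tm s \<and> free_for s x \<phi>)"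

text \<open>The Hilbert calculus for classical first-order logic with equality of Mendelson's
  \<^emph>\<open>Introduction to Mathematical Logic\<close>, with the equality axioms stated for arbitrary
  terms. The rule of generalization is unrestricted, which is sound because the members of
  a theory are sentences.\<close>

inductive prv :: "fm set \<Rightarrow> fm \<Rightarrow> bool" (infix "\<turnstile>" 50) for T :: "fm set" where
  Hyp: "\<phi> \<in> T \<Longrightarrow> T \<turnstile> \<phi>"
| K: "T \<turnstile> Imp \<phi> (Imp \<psi> \<phi>)"
| S: "T \<turnstile> Imp (Imp \<phi> (Imp \<psi> \<chi>)) (Imp (Imp \<phi> \<psi>) (Imp \<phi> \<chi>))"
| Contra: "T \<turnstile> Imp (Imp (Neg \<psi>) (Neg \<phi>)) (Imp (Imp (Neg \<psi>) \<phi>) \<psi>)"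
| Inst: "free_for t x \<phi> \<Longrightarrow> T \<turnstile> Imp (All x \<phi>) (subst \<phi> x t)"
| All_Imp: "x \<notin> fv \<phi> \<Longrightarrow> T \<turnstile> Imp (All x (Imp \<phi> \<psi>)) (Imp \<phi> (All x \<psi>))"
| Refl: "T \<turnstile> Eq t t"
| Leibniz: "free_for t x \<phi> \<Longrightarrow> free_for u x \<phi> \<Longrightarrow>
    T \<turnstile> Imp (Eq t u) (Imp (subst \<phi> x t) (subst \<phi> x u))"
| MP: "T \<turnstile> Imp \<phi> \<psi> \<Longrightarrow> T \<turnstile> \<phi> \<Longrightarrow> T \<turnstile> \<psi>"
| Gen: "T \<turnstile> \<phi> \<Longrightarrow> T \<turnstile> All x \<phi>"

definition incomplete :: "fm set \<Rightarrow> bool" where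
  "incomplete T \<longleftrightarrow> (\<exists>\<sigma>. sentence \<sigma> \<and> \<not> T \<turnstile> \<sigma> \<and> \<not> T \<turnstile> Neg \<sigma>)"


section \<open>Goedel numbering\<close>

primrec gn_tm :: "tm \<Rightarrow> nat" where
  "gn_tm (Var i) = prod_encode (0, i)"
| "gn_tm Zero = prod_encode (1, 0)"
| "gn_tm (Succ t) = prod_encode (2, gn_tm t)"
| "gn_tm (Add t u) = prod_encode (3, prod_encode (gn_tm t, gn_tm u))"
| "gn_tm (Mul t u) = prod_encode (4, prod_encode (gn_tm t, gn_tm u))"

primrec gn :: "fm \<Rightarrow> nat" where
  "gn (Eq t u) = prod_encode (0, prod_encode (gn_tm t, gn_tm u))"
| "gn (Le t u) = prod_encode (1, prod_encode (gn_tm t, gn_tm u))"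
| "gn (Neg \<phi>) = prod_encode (2, gn \<phi>)"
| "gn (Imp \<phi> \<psi>) = prod_encode (3, prod_encode (gn \<phi>, gn \<psi>))"
| "gn (All x \<phi>) = prod_encode (4, prod_encode (x, gn \<phi>))"

lemma gn_tm_inject: "gn_tm t = gn_tm u \<longleftrightarrow> t = u"
proof (induction t arbitrary: u)
  case (Var i) show ?case by (cases u) auto
next
  case Zero show ?case by (cases u) auto
next
  case (Succ t) then show ?case by (cases u) auto
next
  case (Add t1 t2) then show ?case by (cases u) auto
next
  case (Mul t1 t2) then show ?case by (cases u) auto
qed

lemma gn_inject: "gn \<phi> = gn \<psi> \<longleftrightarrow> \<phi> = \<psi>"
proof (induction \<phi> arbitrary: \<psi>)
  case (Eq t u) show ?case by (cases \<psi>) (auto simp: gn_tm_inject)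
next
  case (Le t u) show ?case by (cases \<psi>) (auto simp: gn_tm_inject)
next
  case (Neg \<phi>) then show ?case by (cases \<psi>) auto
next
  case (Imp \<phi>1 \<phi>2) then show ?case by (cases \<psi>) auto
next
  case (All x \<phi>) then show ?case by (cases \<psi>) auto
qed

definition Pr :: "fm set \<Rightarrow> nat set" where
  "Pr T = {gn \<sigma> | \<sigma>. sentence \<sigma> \<and> T \<turnstile> \<sigma>}"


section \<open>Recursive sets\<close>

datatype recf =
    RZero
  | RSucc
  | RProj nat
  | RComp recf "recf list"
  | RPrim recf recf
  | RMu recf

text \<open>\<open>reval f xs y\<close>: the partial recursive function denoted by \<open>f\<close> is defined at
  the argument tuple \<open>xs\<close>, with value \<open>y\<close>. Minimization searches over the first
  argument and requires all values below the minimum to be defined.\<close>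

inductive reval :: "recf \<Rightarrow> nat list \<Rightarrow> nat \<Rightarrow> bool" where
  zero: "reval RZero xs 0"
| succ: "reval RSucc [x] (Suc x)"
| proj: "i < length xs \<Longrightarrow> reval (RProj i) xs (xs ! i)"
| comp: "list_all2 (\<lambda>g y. reval g xs y) gs ys \<Longrightarrow> reval f ys z \<Longrightarrow>
    reval (RComp f gs) xs z"
| prim_0: "reval f xs y \<Longrightarrow> reval (RPrim f g) (0 # xs) y"
| prim_Suc: "reval (RPrim f g) (n # xs) y \<Longrightarrow> reval g (n # y # xs) z \<Longrightarrow>
    reval (RPrim f g) (Suc n # xs) z"
| mu: "reval f (n # xs) 0 \<Longrightarrow> (\<forall>m<n. \<exists>k. reval f (m # xs) (Suc k)) \<Longrightarrow>
    reval (RMu f) xs n"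

definition recursive_set :: "nat set \<Rightarrow> bool" where
  "recursive_set A \<longleftrightarrow> (\<exists>f. \<forall>n. reval f [n] (if n \<in> A then 1 else 0))"

text \<open>Values are unique, so \<open>recursive_set A\<close> says that \<open>f\<close> computes the
  characteristic function of \<open>A\<close>.\<close>

inductive_cases reval_elims:
  "reval RZero xs y" "reval RSucc xs y" "reval (RProj i) xs y" "reval (RComp f gs) xs y"
  "reval (RPrim f g) (0 # xs) y" "reval (RPrim f g) (Suc n # xs) y" "reval (RMu f) xs y"

lemma reval_functional: "reval f xs y \<Longrightarrow> reval f xs y' \<Longrightarrow> y' = y"
proof (induction f xs y arbitrary: y' rule: reval.induct)
  case (zero xs)
  then show ?case by (rule reval_elims(1))
next
  case (succ x)
  then show ?case by (rule reval_elims(2)) simp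
next
  case (proj i xs)
  from proj.prems show ?case by (rule reval_elims(3))
next
  case (comp xs gs ys f z)
  from comp.prems obtain ys' where
    *: "list_all2 (\<lambda>g y. reval g xs y) gs ys'" "reval f ys' y'"
    by (rule reval_elims(4))
  have "ys' = ys"
  proof (rule nth_equalityI)
    show "length ys' = length ys"
      using list_all2_lengthD[OF comp.IH(1)] list_all2_lengthD[OF *(1)] by simp
    fix i assume "i < length ys'"
    then have i: "i < length gs" by (simp add: list_all2_lengthD[OF *(1)])
    from list_all2_nthD[OF comp.IH(1) i] list_all2_nthD[OF *(1) i]
    show "ys' ! i = ys ! i" by simp
  qed
  then show ?case using comp.IH(2) *(2) by blast
next
  case (prim_0 f xs y g)
  from prim_0.prems show ?case by (rule reval_elims(5)) (rule prim_0.IH)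
next
  case (prim_Suc f g n xs y z)
  from prim_Suc.prems obtain w where "reval (RPrim f g) (n # xs) w" "reval g (n # w # xs) y'"
    by (rule reval_elims(6))
  then show ?case using prim_Suc.IH by blast
next
  case (mu f n xs)
  from mu.prems have *: "reval f (y' # xs) 0" "\<forall>m<y'. \<exists>k. reval f (m # xs) (Suc k)"
    by (auto elim: reval_elims(7))
  show ?case
  proof (rule linorder_cases[of y' n])
    assume "y' < n"
    then obtain k where "\<forall>v. reval f (y' # xs) v \<longrightarrow> v = Suc k" using mu.IH(2) by blast
    then show ?thesis using *(1) by blast
  next
    assume "n < y'"
    then obtain k where "reval f (n # xs) (Suc k)" using *(2) by blast
    then show ?thesis using mu.IH(1) by blast
  qed
qed

definition recursively_axiomatizable :: "fm set \<Rightarrow> bool" where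
  "recursively_axiomatizable T \<longleftrightarrow>
     (\<exists>T'. is_theory T' \<and> recursive_set (gn ` T') \<and>
        (\<forall>\<sigma>. sentence \<sigma> \<longrightarrow> (T \<turnstile> \<sigma> \<longleftrightarrow> T' \<turnstile> \<sigma>)))"

end

theory Submission
  imports Defs
begin

text \<open>If \<open>T\<close> were sound and complete, its theorems would be exactly the true sentences, so a definition
  of \<open>Pr T\<close> would define truth, against Tarski's theorem. The diagonal sentence of \<open>\<phi>\<close> is taken to be
  \<open>\<forall>v\<^sub>0 (v\<^sub>0 = n \<longrightarrow> \<phi>)\<close>, with the numeral of the code of \<open>\<phi>\<close> for \<open>n\<close>, so no substitution is needed.

  That syntax, recursive functions and provability are arithmetical is all reduced to one closure
  property: a set generated from an arithmetical set by an arithmetical ternary rule (two premises, one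
  conclusion) is arithmetical, because a finite derivation can be coded by three numbers by means of
  divisibility by pairwise coprime moduli.\<close>

section \<open>Free variables and the coincidence lemma\<close>

lemma finite_fv_tm: "finite (fv_tm t)"
  by (induction t) auto

lemma finite_fv: "finite (fv \<phi>)"
  by (induction \<phi>) (auto simp: finite_fv_tm)

lemma val_cong: "(\<And>i. i \<in> fv_tm t \<Longrightarrow> e i = e' i) \<Longrightarrow> val e t = val e' t"
  by (induction t) auto

lemma sat_cong: "(\<And>i. i \<in> fv \<phi> \<Longrightarrow> e i = e' i) \<Longrightarrow> sat e \<phi> \<longleftrightarrow> sat e' \<phi>"
proof (induction \<phi> arbitrary: e e')
  case (Eq t u)
  have "val e t = val e' t" "val e u = val e' u" by (intro val_cong Eq; simp)+
  then show ?case by simp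
next
  case (Le t u)
  have "val e t = val e' t" "val e u = val e' u" by (intro val_cong Le; simp)+
  then show ?case by simp
next
  case (Neg \<phi>)
  have "sat e \<phi> \<longleftrightarrow> sat e' \<phi>" by (intro Neg; simp)
  then show ?case by simp
next
  case (Imp \<phi> \<psi>)
  have "sat e \<phi> \<longleftrightarrow> sat e' \<phi>" "sat e \<psi> \<longleftrightarrow> sat e' \<psi>" by (intro Imp; simp)+
  then show ?case by simp
next
  case (All x \<phi>)
  have "sat (e(x := n)) \<phi> \<longleftrightarrow> sat (e'(x := n)) \<phi>" for n
    by (rule All.IH) (simp add: All.prems)
  then show ?case by simp
qed

section \<open>Soundness of the calculus\<close>

lemma val_subst: "val e (subst_tm t x s) = val (e(x := val e s)) t"
  by (induction t) auto

lemma subst_tm_fresh: "x \<notin> fv_tm t \<Longrightarrow> subst_tm t x s = t"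
  by (induction t) auto

lemma subst_fresh: "x \<notin> fv \<phi> \<Longrightarrow> subst \<phi> x s = \<phi>"
  by (induction \<phi>) (auto simp: subst_tm_fresh)

lemma sat_subst:
  "free_for s x \<phi> \<Longrightarrow> sat e (subst \<phi> x s) \<longleftrightarrow> sat (e(x := val e s)) \<phi>"
proof (induction \<phi> arbitrary: e)
  case (All y \<phi>)
  show ?case
  \<comment> \<open>\<open>free_for\<close> asks nothing of the body when \<open>x\<close> is not
    free in the quantified formula. In that case the substitution changes nothing, and neither does
    updating \<open>e\<close> at \<open>x\<close>.\<close>
  proof (cases "x \<in> fv (All y \<phi>)")
    case False
    then have "sat (e(x := val e s)) (All y \<phi>) \<longleftrightarrow> sat e (All y \<phi>)"
      by (intro sat_cong) auto
    then show ?thesis using False by (metis subst_fresh)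
  next
    case True
    then have y: "y \<noteq> x" "y \<notin> fv_tm s" "free_for s x \<phi>" using All.prems by auto
    have "sat (e(y := n)) (subst \<phi> x s) \<longleftrightarrow> sat (e(x := val e s, y := n)) \<phi>" for n
    proof -
      have "val (e(y := n)) s = val e s" using y(2) by (intro val_cong) auto
      then show ?thesis by (metis All.IH y(1,3) fun_upd_twist)
    qed
    then show ?thesis using y(1) by (simp del: fun_upd_apply)
  qed
qed (auto simp: val_subst)

text \<open>The induction runs over all environments at once: for \<open>Gen\<close> the induction
  hypothesis is applied at every \<open>e(x := n)\<close>.\<close>

lemma sat_prv:
  assumes "sound T" "T \<turnstile> \<phi>"
  shows "sat e \<phi>"
  using assms(2)
proof (induction arbitrary: e)
  case (Hyp \<phi>)
  then show ?case using assms(1) by (simp add: sound_def true_in_omega_def)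
next
  case (Inst t x \<phi>)
  then show ?case by (simp add: sat_subst)
next
  case (All_Imp x \<phi> \<psi>)
  then have "sat (e(x := n)) \<phi> \<longleftrightarrow> sat e \<phi>" for n
    by (intro sat_cong) auto
  then show ?case by auto
next
  case (Leibniz t x \<phi> u)
  then show ?case by (simp add: sat_subst)
qed auto


section \<open>Arithmetical predicates\<close>

text \<open>Predicates and functions on environments; quantifiers are treated in the style of
  de Bruijn: the body of a quantifier refers to the bound variable as \<open>e 0\<close> and to the
  surrounding environment as \<open>\<lambda>i. e (Suc i)\<close>.\<close>

definition arith :: "((nat \<Rightarrow> nat) \<Rightarrow> bool) \<Rightarrow> bool" where
  "arith P \<longleftrightarrow> (\<exists>\<phi>. \<forall>e. sat e \<phi> \<longleftrightarrow> P e)"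

named_theorems arith_intros

section \<open>Renaming of variables\<close>

primrec rename_tm :: "(nat \<Rightarrow> nat) \<Rightarrow> tm \<Rightarrow> tm" where
  "rename_tm r (Var i) = Var (r i)"
| "rename_tm r Zero = Zero"
| "rename_tm r (Succ t) = Succ (rename_tm r t)"
| "rename_tm r (Add t u) = Add (rename_tm r t) (rename_tm r u)"
| "rename_tm r (Mul t u) = Mul (rename_tm r t) (rename_tm r u)"

lemma fv_rename_tm: "fv_tm (rename_tm r t) = r ` fv_tm t"
  by (induction t) auto

lemma val_rename_tm: "val e (rename_tm r t) = val (\<lambda>i. e (r i)) t"
  by (induction t) auto

text \<open>Since \<open>r\<close> may send a parameter onto a bound variable, each quantifier first
  gets a fresh bound name outside the image of the free variables. The bound on \<open>fv\<close>
  also yields, later, formulas with a single free variable.\<close>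

lemma ex_rename: "\<exists>\<psi>. fv \<psi> \<subseteq> r ` fv \<phi> \<and> (\<forall>e. sat e \<psi> \<longleftrightarrow> sat (\<lambda>i. e (r i)) \<phi>)"
proof (induction \<phi> arbitrary: r)
  case (Eq t u)
  show ?case
    by (rule exI[of _ "Eq (rename_tm r t) (rename_tm r u)"])
      (simp add: fv_rename_tm val_rename_tm image_Un)
next
  case (Le t u)
  show ?case
    by (rule exI[of _ "Le (rename_tm r t) (rename_tm r u)"])
      (simp add: fv_rename_tm val_rename_tm image_Un)
next
  case (Neg \<phi>)
  then obtain \<psi> where "fv \<psi> \<subseteq> r ` fv \<phi>" "\<forall>e. sat e \<psi> \<longleftrightarrow> sat (\<lambda>i. e (r i)) \<phi>" by blast
  then show ?case by (intro exI[of _ "Neg \<psi>"]) simp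
next
  case (Imp \<phi> \<phi>')
  obtain \<psi> where "fv \<psi> \<subseteq> r ` fv \<phi>" "\<forall>e. sat e \<psi> \<longleftrightarrow> sat (\<lambda>i. e (r i)) \<phi>"
    using Imp(1) by blast
  moreover obtain \<psi>' where "fv \<psi>' \<subseteq> r ` fv \<phi>'" "\<forall>e. sat e \<psi>' \<longleftrightarrow> sat (\<lambda>i. e (r i)) \<phi>'"
    using Imp(2) by blast
  ultimately show ?case by (intro exI[of _ "Imp \<psi> \<psi>'"]) auto
next
  case (All x \<phi>)
  obtain y where y: "y \<notin> r ` fv \<phi>"
    using ex_new_if_finite[of "r ` fv \<phi>"] finite_fv by auto
  from All[of "r(x := y)"] obtain \<psi> where \<psi>: "fv \<psi> \<subseteq> (r(x := y)) ` fv \<phi>"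
    "\<And>e. sat e \<psi> \<longleftrightarrow> sat (\<lambda>i. e ((r(x := y)) i)) \<phi>" by auto
  have "sat (\<lambda>i. (e(y := n)) ((r(x := y)) i)) \<phi> \<longleftrightarrow> sat ((\<lambda>i. e (r i))(x := n)) \<phi>" for e n
    using y by (intro sat_cong) auto
  then show ?case using \<psi> by (intro exI[of _ "All y \<psi>"]) auto
qed

lemma arith_rename:
  assumes "arith P"
  shows "arith (\<lambda>e. P (\<lambda>i. e (r i)))"
proof -
  obtain \<phi> where "\<forall>e. sat e \<phi> \<longleftrightarrow> P e" using assms unfolding arith_def by blast
  moreover obtain \<psi> where "\<forall>e. sat e \<psi> \<longleftrightarrow> sat (\<lambda>i. e (r i)) \<phi>" using ex_rename by blast
  ultimately show ?thesis unfolding arith_def by auto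
qed

section \<open>Closure under connectives and quantifiers\<close>

lemma arith_Not [arith_intros]:
  assumes "arith P"
  shows "arith (\<lambda>e. \<not> P e)"
proof -
  obtain \<phi> where "\<forall>e. sat e \<phi> \<longleftrightarrow> P e" using assms unfolding arith_def by blast
  then show ?thesis unfolding arith_def by (intro exI[of _ "Neg \<phi>"]) simp
qed

lemma arith_imp [arith_intros]:
  assumes "arith P" "arith Q"
  shows "arith (\<lambda>e. P e \<longrightarrow> Q e)"
proof -
  obtain \<phi> \<psi> where "\<forall>e. sat e \<phi> \<longleftrightarrow> P e" "\<forall>e. sat e \<psi> \<longleftrightarrow> Q e"
    using assms unfolding arith_def by blast
  then show ?thesis unfolding arith_def by (intro exI[of _ "Imp \<phi> \<psi>"]) simp
qed

lemma arith_disj [arith_intros]: "arith P \<Longrightarrow> arith Q \<Longrightarrow> arith (\<lambda>e. P e \<or> Q e)"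
  using arith_imp[OF arith_Not, of P Q] by (simp add: disj_imp)

lemma arith_conj [arith_intros]: "arith P \<Longrightarrow> arith Q \<Longrightarrow> arith (\<lambda>e. P e \<and> Q e)"
  using arith_Not[OF arith_imp[OF _ arith_Not], of P Q] by simp

text \<open>The de Bruijn body becomes a formula with named variables: \<open>case_nat y id\<close>
  sends index 0 to the bound variable \<open>y\<close> and moves each parameter \<open>Suc i\<close>
  back to \<open>i\<close>.\<close>

lemma arith_all_nat:
  assumes "arith (\<lambda>e. P (e 0) (\<lambda>i. e (Suc i)))"
  shows "arith (\<lambda>e. \<forall>n. P n e)"
proof -
  obtain \<phi> where \<phi>: "sat e \<phi> \<longleftrightarrow> P (e 0) (\<lambda>i. e (Suc i))" for e
    using assms unfolding arith_def by blast
  \<comment> \<open>Excluding 0 makes \<open>k\<close> a successor \<open>Suc y\<close>, so no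
    parameter of the body is moved onto the bound variable \<open>y\<close>.\<close>
  obtain k where "k \<notin> insert 0 (fv \<phi>)"
    using ex_new_if_finite[of "insert 0 (fv \<phi>)"] finite_fv by auto
  then obtain y where y: "Suc y \<notin> fv \<phi>" by (cases k) auto
  obtain \<psi> where \<psi>: "sat e \<psi> \<longleftrightarrow> sat (\<lambda>i. e (case_nat y id i)) \<phi>" for e
    using ex_rename[of "case_nat y id" \<phi>] by blast
  have "sat (e(y := n)) \<psi> \<longleftrightarrow> P n e" for e n
  proof -
    have "sat (\<lambda>i. (e(y := n)) (case_nat y id i)) \<phi> \<longleftrightarrow> sat (case_nat n e) \<phi>"
      using y by (intro sat_cong) (auto split: nat.split)
    then show ?thesis by (simp add: \<phi> \<psi>)
  qed
  then show ?thesis unfolding arith_def by (intro exI[of _ "All y \<psi>"]) simp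
qed

lemma arith_ex_nat:
  assumes "arith (\<lambda>e. P (e 0) (\<lambda>i. e (Suc i)))"
  shows "arith (\<lambda>e. \<exists>n. P n e)"
  using arith_Not[OF arith_all_nat[of "\<lambda>n e. \<not> P n e", OF arith_Not[OF assms]]] by simp

primrec num :: "nat \<Rightarrow> tm" where
  "num 0 = Zero"
| "num (Suc n) = Succ (num n)"

lemma val_num [simp]: "val e (num n) = n"
  by (induction n) auto

lemma fv_num [simp]: "fv_tm (num n) = {}"
  by (induction n) auto

lemma arith_var_eq: "arith (\<lambda>e. e i = e j)"
  unfolding arith_def by (rule exI[of _ "Eq (Var i) (Var j)"]) simp

lemma arith_var_eq_const: "arith (\<lambda>e. e i = n)"
  unfolding arith_def by (rule exI[of _ "Eq (Var i) (num n)"]) simp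

lemma arith_const [arith_intros]: "arith (\<lambda>e. b)"
  unfolding arith_def
  by (rule exI[of _ "if b then Eq Zero Zero else Neg (Eq Zero Zero)"]) simp


text \<open>Renaming every variable to 0 evaluates the formula in a constant environment, which
  gives the same truth value because only \<open>e 0\<close> matters.\<close>

lemma arith_imp_formula:
  assumes "arith (\<lambda>e. e 0 \<in> A)"
  obtains \<phi> where "fv \<phi> \<subseteq> {0}" "\<And>e. sat e \<phi> \<longleftrightarrow> e 0 \<in> A"
proof -
  obtain \<phi> where \<phi>: "\<And>e. sat e \<phi> \<longleftrightarrow> e 0 \<in> A" using assms unfolding arith_def by blast
  obtain \<psi> where \<psi>: "fv \<psi> \<subseteq> (\<lambda>_. 0) ` fv \<phi>" "\<And>e. sat e \<psi> \<longleftrightarrow> sat (\<lambda>i. e 0) \<phi>"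
    using ex_rename[of "\<lambda>_. 0" \<phi>] by blast
  show ?thesis by (rule that[of \<psi>]) (use \<psi> in \<open>auto simp: \<phi>\<close>)
qed

lemma definable_iff_arith: "definable A \<longleftrightarrow> arith (\<lambda>e. e 0 \<in> A)"
proof
  assume "definable A"
  then obtain \<phi> x where *: "\<And>e n. n \<in> A \<longleftrightarrow> sat (e(x := n)) \<phi>" unfolding definable_def by blast
  have "sat e \<phi> \<longleftrightarrow> e x \<in> A" for e using *[of "e x" e] by simp
  then have "arith (\<lambda>e. e x \<in> A)" unfolding arith_def by blast
  then show "arith (\<lambda>e. e 0 \<in> A)" by (rule arith_rename)
next
  assume "arith (\<lambda>e. e 0 \<in> A)"
  then obtain \<phi> where \<phi>: "fv \<phi> \<subseteq> {0}" "\<And>e. sat e \<phi> \<longleftrightarrow> e 0 \<in> A"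
    by (rule arith_imp_formula) blast
  have "n \<in> A \<longleftrightarrow> sat (e(0 := n)) \<phi>" for e n by (simp add: \<phi>(2))
  then show "definable A" unfolding definable_def using \<phi>(1) by blast
qed


section \<open>Coded types\<close>

text \<open>The range has to be arithmetical so that \<open>decode\<close>, junk value included, has
  an arithmetical graph.\<close>

class coded =
  fixes code :: "'a \<Rightarrow> nat"
  assumes inj_code: "inj code"
    and arith_range_code: "arith (\<lambda>e. e 0 \<in> range code)"

text \<open>Off the range of \<^term>\<open>code\<close>, the value of \<open>decode\<close> is a fixed junk element.\<close>

definition decode :: "nat \<Rightarrow> 'a::coded" where
  "decode n = (SOME x. code x = n)"

lemma code_eq_iff [simp]: "code x = code y \<longleftrightarrow> x = y"
  using inj_code by (auto dest: injD)

lemma decode_code [simp]: "decode (code x) = x"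
  by (simp add: decode_def)

lemma code_decode: "n \<in> range (code :: 'a::coded \<Rightarrow> nat) \<Longrightarrow> code (decode n :: 'a) = n"
  by (auto simp: image_iff)

text \<open>\<open>decode\<close> is surjective, so quantifiers over a coded type become quantifiers
  over numbers.\<close>

lemma ex_decode: "(\<exists>x. P x) \<longleftrightarrow> (\<exists>n. P (decode n))"
  by (metis decode_code)

definition arithf :: "((nat \<Rightarrow> nat) \<Rightarrow> 'a::coded) \<Rightarrow> bool" where
  "arithf F \<longleftrightarrow> arith (\<lambda>e. e 0 = code (F (\<lambda>i. e (Suc i))))"

definition arith_pred :: "('a::coded \<Rightarrow> bool) \<Rightarrow> bool" where
  "arith_pred P \<longleftrightarrow> arith (\<lambda>e. P (decode (e 0)))"

lemma arith_all [arith_intros]: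
  fixes P :: "'a::coded \<Rightarrow> (nat \<Rightarrow> nat) \<Rightarrow> bool"
  assumes "arith (\<lambda>e. P (decode (e 0)) (\<lambda>i. e (Suc i)))"
  shows "arith (\<lambda>e. \<forall>x. P x e)"
proof -
  have "(\<forall>x. P x e) \<longleftrightarrow> (\<forall>n. P (decode n) e)" for e
    using ex_decode[of "\<lambda>x. \<not> P x e"] by blast
  then show ?thesis using arith_all_nat[of "\<lambda>n. P (decode n)", OF assms] by simp
qed

lemma arith_ex [arith_intros]:
  fixes P :: "'a::coded \<Rightarrow> (nat \<Rightarrow> nat) \<Rightarrow> bool"
  assumes "arith (\<lambda>e. P (decode (e 0)) (\<lambda>i. e (Suc i)))"
  shows "arith (\<lambda>e. \<exists>x. P x e)"
  using arith_ex_nat[of "\<lambda>n. P (decode n)", OF assms] unfolding ex_decode[of "\<lambda>x. P x _"] .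

text \<open>The value of \<open>F\<close> enters through an existential quantifier and is pinned
  down by its graph.\<close>

lemma arith_let:
  assumes "arith (\<lambda>e. P (e 0) (\<lambda>i. e (Suc i)))" "arithf F"
  shows "arith (\<lambda>e. P (code (F e)) e)"
proof -
  have "arith (\<lambda>e. \<exists>n. n = code (F e) \<and> P n e)"
    using assms by (intro arith_ex_nat arith_conj) (simp_all add: arithf_def)
  then show ?thesis by simp
qed

lemma arith_app: "arith_pred P \<Longrightarrow> arithf F \<Longrightarrow> arith (\<lambda>e. P (F e))"
  using arith_let[of "\<lambda>n e. P (decode n)" F] by (simp add: arith_pred_def)

lemma arith_eq [arith_intros]: "arithf F \<Longrightarrow> arithf G \<Longrightarrow> arith (\<lambda>e. F e = G e)"
  using arith_let[of "\<lambda>n e. n = code (G e)" F] by (simp add: arithf_def)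

text \<open>Index 0 holds the value of the function and must stay fixed; \<open>r\<close> acts on
  the shifted parameters.\<close>

lemma arithf_rename: "arithf F \<Longrightarrow> arithf (\<lambda>e. F (\<lambda>i. e (r i)))"
  using arith_rename[of "\<lambda>e. e 0 = code (F (\<lambda>i. e (Suc i)))" "case_nat 0 (\<lambda>i. Suc (r i))"]
  by (simp add: arithf_def)

lemmas arithf_shift = arithf_rename[where r = Suc]

lemma arithf_const [arith_intros]: "arithf (\<lambda>e. c)"
  unfolding arithf_def by (rule arith_var_eq_const)

lemma arithf_decode [arith_intros]: "arithf (\<lambda>e. decode (e i) :: 'a::coded)"
proof -
  \<comment> \<open>Off the range, \<open>code x = n\<close> is false for every \<open>x\<close>, so
    \<open>decode n\<close> chooses from the empty predicate. All such \<open>n\<close> give the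
    same element, and \<open>c\<close> is its code.\<close>
  define c where "c = code (SOME x::'a. False)"
  have "arith (\<lambda>e. e (Suc i) \<in> range (code :: 'a \<Rightarrow> nat))"
    using arith_rename[OF arith_range_code, of "\<lambda>_. Suc i"] .
  then have *: "arith (\<lambda>e. (e (Suc i) \<in> range (code :: 'a \<Rightarrow> nat) \<and> e 0 = e (Suc i)) \<or>
      (e (Suc i) \<notin> range (code :: 'a \<Rightarrow> nat) \<and> e 0 = c))"
    by (intro arith_disj arith_conj arith_Not arith_var_eq arith_var_eq_const)
  have "code (decode n :: 'a) = c" if "n \<notin> range (code :: 'a \<Rightarrow> nat)" for n
  proof -
    have "(\<lambda>x::'a. code x = n) = (\<lambda>x. False)" using that by auto
    then show ?thesis unfolding c_def decode_def by simp
  qed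
  then have "(e 0 = code (decode (e (Suc i)) :: 'a)) \<longleftrightarrow>
      (e (Suc i) \<in> range (code :: 'a \<Rightarrow> nat) \<and> e 0 = e (Suc i)) \<or>
      (e (Suc i) \<notin> range (code :: 'a \<Rightarrow> nat) \<and> e 0 = c)" for e
    by (cases "e (Suc i) \<in> range (code :: 'a \<Rightarrow> nat)") (simp_all add: code_decode)
  then show ?thesis using * by (simp add: arithf_def)
qed

text \<open>A decoded value does not determine the number, since numbers off the range decode to the
  junk element; conjunction with the range condition removes them.\<close>

lemma arithfI:
  fixes F :: "(nat \<Rightarrow> nat) \<Rightarrow> 'a::coded"
  assumes "arith (\<lambda>e. decode (e 0) = F (\<lambda>i. e (Suc i)))"
  shows "arithf F"
proof -
  have *: "e 0 = code (F (\<lambda>i. e (Suc i))) \<longleftrightarrow>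
      e 0 \<in> range (code :: 'a \<Rightarrow> nat) \<and> decode (e 0) = F (\<lambda>i. e (Suc i))" for e
    by (metis code_decode decode_code rangeI)
  show ?thesis unfolding arithf_def *
    using arith_range_code assms by (rule arith_conj)
qed

section \<open>Numbers and pairs as coded types\<close>

instantiation nat :: coded
begin

definition code_nat :: "nat \<Rightarrow> nat" where "code_nat n = n"

instance
proof
  show "inj (code :: nat \<Rightarrow> nat)" by (simp add: inj_def code_nat_def)
  have "range (code :: nat \<Rightarrow> nat) = UNIV" by (auto simp: code_nat_def)
  then show "arith (\<lambda>e. e 0 \<in> range (code :: nat \<Rightarrow> nat))" by (simp add: arith_const)
qed

end

lemma decode_nat: "decode n = (n :: nat)"
  using decode_code[of n] by (simp add: code_nat_def)

lemma arithf_code [arith_intros]: "arithf F \<Longrightarrow> arithf (\<lambda>e. code (F e))"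
  by (simp add: arithf_def code_nat_def)

lemma arithf_var [arith_intros]: "arithf (\<lambda>e. e i)"
  by (simp add: arithf_def code_nat_def arith_var_eq)

lemma arith_binary:
  fixes F G :: "(nat \<Rightarrow> nat) \<Rightarrow> nat"
  assumes P: "arith (\<lambda>e. P (e 0) (e 1))" and F: "arithf F" and G: "arithf G"
  shows "arith (\<lambda>e. P (F e) (G e))"
proof -
  \<comment> \<open>\<open>arith_let\<close> replaces index 0 only, so the two arguments are
    exchanged in order to insert \<open>G\<close> first and \<open>F\<close> afterwards.\<close>
  have "arith (\<lambda>e. P (e 1) (e 0))"
    using arith_rename[OF P, of "\<lambda>i. 1 - i"] by simp
  then have "arith (\<lambda>e. P (e 0) (G (\<lambda>i. e (Suc i))))"
    using arith_let[of "\<lambda>n e. P (e 0) n" "\<lambda>e. G (\<lambda>i. e (Suc i))"] arithf_rename[OF G]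
    by (simp add: code_nat_def)
  then show ?thesis
    using arith_let[of "\<lambda>n e. P n (G e)" F] F by (simp add: code_nat_def)
qed

lemma arithf_binary:
  fixes F G :: "(nat \<Rightarrow> nat) \<Rightarrow> nat" and h :: "nat \<Rightarrow> nat \<Rightarrow> nat"
  assumes h: "arith (\<lambda>e. e 0 = h (e 1) (e 2))" and F: "arithf F" and G: "arithf G"
  shows "arithf (\<lambda>e. h (F e) (G e))"
proof -
  \<comment> \<open>The truncated difference \<open>2 - i\<close> exchanges 0 and 2 and fixes 1,
    which brings the second argument to index 0.\<close>
  have "arith (\<lambda>e. e 2 = h (e 1) (e 0))"
    using arith_rename[OF h, of "\<lambda>i. 2 - i"] by (simp add: numeral_2_eq_2)
  then have "arith (\<lambda>e. e 1 = h (e 0) (G (\<lambda>i. e (Suc (Suc i)))))"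
    using arith_let[of "\<lambda>n e. e 1 = h (e 0) n" "\<lambda>e. G (\<lambda>i. e (Suc (Suc i)))"]
      arithf_rename[OF G] by (simp add: code_nat_def numeral_2_eq_2)
  then show ?thesis
    using arith_let[of "\<lambda>n e. e 0 = h n (G (\<lambda>i. e (Suc i)))" "\<lambda>e. F (\<lambda>i. e (Suc i))"]
      arithf_rename[OF F] by (simp add: arithf_def code_nat_def)
qed

lemma arithf_add [arith_intros]:
  "arithf F \<Longrightarrow> arithf G \<Longrightarrow> arithf (\<lambda>e. F e + G e :: nat)"
  by (rule arithf_binary, unfold arith_def)
    (auto intro!: exI[of _ "Eq (Var 0) (Add (Var 1) (Var 2))"])

lemma arithf_mult [arith_intros]:
  "arithf F \<Longrightarrow> arithf G \<Longrightarrow> arithf (\<lambda>e. F e * G e :: nat)"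
  by (rule arithf_binary, unfold arith_def)
    (auto intro!: exI[of _ "Eq (Var 0) (Mul (Var 1) (Var 2))"])

lemma arithf_Suc [arith_intros]: "arithf F \<Longrightarrow> arithf (\<lambda>e. Suc (F e))"
  using arithf_add[OF arithf_const, of F 1] by simp

lemma arith_le [arith_intros]:
  "arithf F \<Longrightarrow> arithf G \<Longrightarrow> arith (\<lambda>e. F e \<le> (G e :: nat))"
  by (rule arith_binary, unfold arith_def)
    (auto intro!: exI[of _ "Le (Var 0) (Var 1)"])

lemma arith_less [arith_intros]:
  "arithf F \<Longrightarrow> arithf G \<Longrightarrow> arith (\<lambda>e. F e < (G e :: nat))"
  unfolding Suc_le_eq[symmetric] by (intro arith_intros)

lemma arith_dvd [arith_intros]:
  assumes "arithf F" "arithf G"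
  shows "arith (\<lambda>e. F e dvd (G e :: nat))"
  unfolding dvd_def by (intro arith_intros arithf_shift assms)

text \<open>Doubling removes the division by two in \<open>triangle\<close> and leaves a polynomial
  equation.\<close>

lemma prod_encode_graph:
  "c = prod_encode (a, b) \<longleftrightarrow> c + c = (a + b) * Suc (a + b) + (a + a)"
proof -
  have "2 * triangle (a + b) = (a + b) * Suc (a + b)"
    unfolding triangle_def by (rule dvd_mult_div_cancel) (metis even_Suc even_mult_iff)
  moreover have "c = t + a \<longleftrightarrow> c + c = x + (a + a)" if "2 * t = x" for t x
    using that by linarith
  ultimately show ?thesis by (simp only: prod_encode_def prod.case)
qed

lemma arithf_prod_encode [arith_intros]:
  "arithf F \<Longrightarrow> arithf G \<Longrightarrow> arithf (\<lambda>e. prod_encode (F e, G e))"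
  by (rule arithf_binary, unfold prod_encode_graph) (intro arith_intros)

instantiation prod :: (coded, coded) coded
begin

definition code_prod :: "'a \<times> 'b \<Rightarrow> nat" where
  "code_prod p = prod_encode (code (fst p), code (snd p))"

instance
proof
  show "inj (code :: 'a \<times> 'b \<Rightarrow> nat)" by (auto simp: inj_def code_prod_def)
  have "e 0 \<in> range (code :: 'a \<times> 'b \<Rightarrow> nat) \<longleftrightarrow>
      (\<exists>(x::'a) (y::'b). e 0 = prod_encode (code x, code y))" for e :: "nat \<Rightarrow> nat"
    by (auto simp: code_prod_def image_iff)
  then show "arith (\<lambda>e. e 0 \<in> range (code :: 'a \<times> 'b \<Rightarrow> nat))"
    by (simp only:) (intro arith_intros)
qed

end

lemma arithf_Pair [arith_intros]:
  "arithf F \<Longrightarrow> arithf G \<Longrightarrow> arithf (\<lambda>e. (F e, G e))"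
  using arithf_prod_encode[OF arithf_code arithf_code, of F G]
  by (simp add: arithf_def code_nat_def code_prod_def)

lemma arithf_fst [arith_intros]:
  assumes "arithf F"
  shows "arithf (\<lambda>e. fst (F e))"
proof (rule arithfI)
  have *: "decode (e 0) = fst (F (\<lambda>i. e (Suc i))) \<longleftrightarrow> (\<exists>y. F (\<lambda>i. e (Suc i)) = (decode (e 0), y))" for e
    by (cases "F (\<lambda>i. e (Suc i))") auto
  show "arith (\<lambda>e. decode (e 0) = fst (F (\<lambda>i. e (Suc i))))"
    unfolding * by (intro arith_intros arithf_rename[OF assms])
qed

lemma arithf_snd [arith_intros]:
  assumes "arithf F"
  shows "arithf (\<lambda>e. snd (F e))"
proof (rule arithfI)
  have *: "decode (e 0) = snd (F (\<lambda>i. e (Suc i))) \<longleftrightarrow> (\<exists>y. F (\<lambda>i. e (Suc i)) = (y, decode (e 0)))" for e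
    by (cases "F (\<lambda>i. e (Suc i))") auto
  show "arith (\<lambda>e. decode (e 0) = snd (F (\<lambda>i. e (Suc i))))"
    unfolding * by (intro arith_intros arithf_rename[OF assms])
qed

lemma arith_case_prod [arith_intros]:
  "arith (\<lambda>e. P (fst (F e)) (snd (F e)) e) \<Longrightarrow> arith (\<lambda>e. case F e of (x, y) \<Rightarrow> P x y e)"
  by (simp add: case_prod_beta)


section \<open>Inductively generated sets\<close>

text \<open>A finite set \<open>F \<subseteq> {..N}\<close> is coded by \<open>b = N!\<close> and the product \<open>a\<close> of the pairwise coprime
  numbers \<open>1 + (p + 1) b\<close>, for \<open>p \<in> F\<close>.\<close>

definition mem_code :: "nat \<Rightarrow> nat \<Rightarrow> nat \<Rightarrow> nat \<Rightarrow> bool" where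
  "mem_code a b N p \<longleftrightarrow> p \<le> N \<and> Suc (Suc p * b) dvd a"

text \<open>A common divisor is coprime to \<open>fact N\<close>, as each modulus is one more than a
  multiple of it. It divides the difference \<open>(q - p) * fact N\<close>, hence
  \<open>q - p\<close>, which itself divides \<open>fact N\<close>.\<close>

lemma coprime_moduli:
  fixes p q N :: nat
  assumes "p \<le> N" "q \<le> N" "p \<noteq> q"
  shows "coprime (Suc (Suc p * fact N)) (Suc (Suc q * fact N))"
  using assms
proof (induction p q rule: linorder_wlog)
  case (le p q)
  show ?case
  proof (rule coprimeI)
    fix d :: nat
    assume d: "d dvd Suc (Suc p * fact N)" "d dvd Suc (Suc q * fact N)"
    have "coprime d (fact N)"
    proof (rule coprimeI)
      fix c :: nat
      assume "c dvd d" "c dvd fact N"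
      then have "c dvd Suc (Suc p * fact N)" "c dvd Suc p * fact N"
        using d(1) by (auto intro: dvd_trans)
      then show "is_unit c" by (metis Suc_eq_plus1 dvd_add_right_iff)
    qed
    moreover have "Suc (Suc q * fact N) - Suc (Suc p * fact N) = (q - p) * fact N"
      by (simp add: diff_mult_distrib)
    then have "d dvd (q - p) * fact N" using d by (metis dvd_diff_nat)
    ultimately have "d dvd q - p" by (simp add: coprime_dvd_mult_left_iff)
    moreover have "q - p dvd fact N" using le by (intro dvd_fact) auto
    ultimately show "is_unit d" using \<open>coprime d (fact N)\<close>
      by (metis coprime_common_divisor dvd_refl dvd_trans)
  qed
next
  case (sym p q)
  then show ?case by (simp add: coprime_commute)
qed

text \<open>The modulus of a nonmember is coprime to every factor of \<open>a\<close>, hence to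
  \<open>a\<close>; being greater than 1, it cannot divide \<open>a\<close>.\<close>

lemma ex_mem_code:
  assumes "finite F"
  shows "\<exists>a b N. \<forall>p. mem_code a b N p \<longleftrightarrow> p \<in> F"
proof -
  obtain N where N: "\<forall>p\<in>F. p \<le> N" using assms finite_nat_set_iff_bounded_le by auto
  define m :: "nat \<Rightarrow> nat" where "m p = Suc (Suc p * fact N)" for p
  define a where "a = prod m F"
  have "p \<in> F" if p: "p \<le> N" "m p dvd a" for p
  proof (rule ccontr)
    assume "p \<notin> F"
    then have "coprime (m p) a" unfolding a_def m_def
      using p N by (intro prod_coprime_right coprime_moduli) auto
    then have "m p dvd 1" using p by (metis coprime_common_divisor dvd_refl)
    then show False by (simp add: m_def)
  qed
  moreover have "m p dvd a" if "p \<in> F" for p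
    using that assms by (auto simp: a_def)
  ultimately show ?thesis using N unfolding mem_code_def m_def by blast
qed

text \<open>Rules with a single premise fit this form by taking the same premise twice.\<close>

inductive ind :: "('a \<Rightarrow> bool) \<Rightarrow> ('a \<Rightarrow> 'a \<Rightarrow> 'a \<Rightarrow> bool) \<Rightarrow> 'a \<Rightarrow> bool"
  for A R where
  base: "A x \<Longrightarrow> ind A R x"
| step: "ind A R y \<Longrightarrow> ind A R z \<Longrightarrow> R y z x \<Longrightarrow> ind A R x"

text \<open>Tagging members with stages rules out circular support, so a derivation can be a mere set.\<close>

definition derivation :: "('a \<Rightarrow> bool) \<Rightarrow> ('a \<Rightarrow> 'a \<Rightarrow> 'a \<Rightarrow> bool) \<Rightarrow> (nat \<times> 'a \<Rightarrow> bool) \<Rightarrow> bool" where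
  "derivation A R D \<longleftrightarrow> (\<forall>k x. D (k, x) \<longrightarrow>
     A x \<or> (\<exists>i y j z. D (i, y) \<and> D (j, z) \<and> i < k \<and> j < k \<and> R y z x))"

text \<open>Strong induction on the stage, since premises sit at smaller stages.\<close>

lemma derivation_imp_ind:
  assumes "derivation A R D" "D (k, x)"
  shows "ind A R x"
  using assms(2)
proof (induction k arbitrary: x rule: less_induct)
  case (less k)
  then consider "A x" | i y j z where "D (i, y)" "D (j, z)" "i < k" "j < k" "R y z x"
    using assms(1) unfolding derivation_def by blast
  then show ?case
  proof cases
    case 1
    then show ?thesis by (rule ind.base)
  next
    case 2
    then show ?thesis using less.IH by (intro ind.step[of A R y z x])
  qed
qed

lemma ind_imp_derivation:
  assumes "ind A R x"
  shows "\<exists>F k. finite F \<and> derivation A R (\<lambda>p. p \<in> F) \<and> (k, x) \<in> F"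
  using assms
proof induction
  case (base x)
  then show ?case by (intro exI[of _ "{(0, x)}"] exI[of _ 0]) (simp add: derivation_def)
next
  case (step y z x)
  then obtain F G i j where *: "finite F" "derivation A R (\<lambda>p. p \<in> F)" "(i, y) \<in> F"
    "finite G" "derivation A R (\<lambda>p. p \<in> G)" "(j, z) \<in> G" by blast
  \<comment> \<open>Being a derivation survives unions, and the stage \<open>Suc (i + j)\<close>
    exceeds those of both premises.\<close>
  define E where "E = insert (Suc (i + j), x) (F \<union> G)"
  have E: "F \<subseteq> E" "G \<subseteq> E" "(i, y) \<in> E" "(j, z) \<in> E" using * by (auto simp: E_def)
  have "A w \<or> (\<exists>i y j z. (i, y) \<in> E \<and> (j, z) \<in> E \<and> i < k \<and> j < k \<and> R y z w)"
    if "(k, w) \<in> E" for k w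
  proof -
    from that consider "k = Suc (i + j)" "w = x" | "(k, w) \<in> F" | "(k, w) \<in> G"
      by (auto simp: E_def)
    then show ?thesis
    proof cases
      case 1
      then have "i < k" "j < k" "R y z w" using step.hyps(3) by auto
      then show ?thesis using E(3,4) by metis
    next
      case 2
      with *(2) have "A w \<or> (\<exists>i y j z. (i, y) \<in> F \<and> (j, z) \<in> F \<and> i < k \<and> j < k \<and> R y z w)"
        unfolding derivation_def by metis
      then show ?thesis using E(1) by (metis subsetD)
    next
      case 3
      with *(5) have "A w \<or> (\<exists>i y j z. (i, y) \<in> G \<and> (j, z) \<in> G \<and> i < k \<and> j < k \<and> R y z w)"
        unfolding derivation_def by metis
      then show ?thesis using E(2) by (metis subsetD)
    qed
  qed
  then have "derivation A R (\<lambda>p. p \<in> E)" unfolding derivation_def by metis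
  moreover have "finite E" "(Suc (i + j), x) \<in> E" using *(1,4) by (auto simp: E_def)
  ultimately show ?case by metis
qed

text \<open>This trades a quantifier over finite sets for three quantifiers over numbers. From right
  to left, any three numbers whose decoded set is a derivation will do, so factorials are never
  expressed in a formula.\<close>

lemma ind_iff_mem_code:
  fixes A :: "'a::coded \<Rightarrow> bool"
  shows "ind A R x \<longleftrightarrow> (\<exists>a b N. derivation A R (\<lambda>p. mem_code a b N (code p)) \<and>
    (\<exists>k::nat. mem_code a b N (code (k, x))))"
proof
  assume "ind A R x"
  then obtain F k where F: "finite F" "derivation A R (\<lambda>p. p \<in> F)" "(k, x) \<in> F"
    by (auto dest: ind_imp_derivation)
  obtain a b N where "\<forall>p. mem_code a b N p \<longleftrightarrow> p \<in> code ` F"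
    using ex_mem_code[of "code ` F"] F(1) by auto
  then have *: "mem_code a b N (code p) \<longleftrightarrow> p \<in> F" for p
    by (simp add: image_iff)
  have "derivation A R (\<lambda>p. mem_code a b N (code p)) \<and> mem_code a b N (code (k, x))"
    unfolding * using F(2,3) by (rule conjI)
  then show "\<exists>a b N. derivation A R (\<lambda>p. mem_code a b N (code p)) \<and>
      (\<exists>k::nat. mem_code a b N (code (k, x)))" by blast
next
  assume "\<exists>a b N. derivation A R (\<lambda>p. mem_code a b N (code p)) \<and>
    (\<exists>k::nat. mem_code a b N (code (k, x)))"
  then obtain a b N and k :: nat where "derivation A R (\<lambda>p. mem_code a b N (code p))"
    "mem_code a b N (code (k, x))" by blast
  then show "ind A R x" by (rule derivation_imp_ind)
qed

lemma arith_mem_code: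
  "arithf F \<Longrightarrow> arithf G \<Longrightarrow> arithf H \<Longrightarrow> arithf K \<Longrightarrow>
    arith (\<lambda>e. mem_code (F e) (G e) (H e) (K e))"
  unfolding mem_code_def by (intro arith_intros)

lemma arith_app2:
  assumes "arith_pred (\<lambda>(x, y). P x y)" "arithf F" "arithf G"
  shows "arith (\<lambda>e. P (F e) (G e))"
  using arith_app[OF assms(1) arithf_Pair[OF assms(2,3)]] by simp

lemma arith_app3:
  assumes "arith_pred (\<lambda>(x, y, z). P x y z)" "arithf F" "arithf G" "arithf H"
  shows "arith (\<lambda>e. P (F e) (G e) (H e))"
  using arith_app[OF assms(1) arithf_Pair[OF assms(2) arithf_Pair[OF assms(3,4)]]] by simp

text \<open>With derivations coded by numbers, only quantifiers over coded types, divisibility and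
  the given predicates remain.\<close>

lemma arith_pred_ind:
  fixes A :: "'a::coded \<Rightarrow> bool"
  assumes A: "arith_pred A" and R: "arith_pred (\<lambda>(y, z, x). R y z x)"
  shows "arith_pred (ind A R)"
  unfolding arith_pred_def ind_iff_mem_code derivation_def
  by (intro arith_intros arith_mem_code arith_app[OF A] arith_app3[OF R])

text \<open>The measure makes the solution of the equation for \<open>X\<close> unique; this is used for structural
  recursion.\<close>

lemma arith_pred_rec:
  fixes X :: "'a::coded \<Rightarrow> bool" and m :: "'a \<Rightarrow> nat"
  assumes A: "arith_pred A" and R: "arith_pred (\<lambda>(y, z, x). R y z x)"
    and m: "\<And>x y z. R y z x \<Longrightarrow> m y < m x \<and> m z < m x"
    and X: "\<And>x. X x \<longleftrightarrow> A x \<or> (\<exists>y z. X y \<and> X z \<and> R y z x)"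
  shows "arith_pred X"
proof -
  \<comment> \<open>The decreasing measure turns repeated unfolding of the equation into a finite
    derivation. The converse inclusion holds for any solution of the equation.\<close>
  have "X x \<Longrightarrow> ind A R x" for x
  proof (induction x rule: measure_induct_rule[of m])
    case (less x)
    then consider "A x" | y z where "X y" "X z" "R y z x" using X by blast
    then show ?case
    proof cases
      case 1
      then show ?thesis by (rule ind.base)
    next
      case 2
      then show ?thesis using less.IH m by (intro ind.step[of A R y z x]) blast+
    qed
  qed
  moreover have "ind A R x \<Longrightarrow> X x" for x
    by (induction rule: ind.induct) (use X in blast)+
  ultimately have "X = ind A R" by blast
  then show ?thesis using arith_pred_ind[OF A R] by (simp only:)
qed

instantiation list :: (coded) coded
begin

definition code_list :: "'a list \<Rightarrow> nat" where
  "code_list xs = list_encode (map code xs)"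

instance
proof
  show "inj (code :: 'a list \<Rightarrow> nat)"
    using inj_map_eq_map[OF inj_code] by (auto simp: inj_def code_list_def list_encode_eq)
  \<comment> \<open>A list code is 0 or the successor of a pair of an element code and a list code,
    so the range is generated from 0 by this rule.\<close>
  define R where "R = (\<lambda>y (z::nat) n. \<exists>x::'a. n = Suc (prod_encode (code x, y)))"
  have "ind (\<lambda>n. n = 0) R (list_encode (map code xs))" for xs :: "'a list"
  proof (induction xs)
    case Nil
    show ?case by (rule ind.base) simp
  next
    case (Cons x xs)
    show ?case by (rule ind.step[OF Cons Cons]) (auto simp: R_def)
  qed
  moreover have "\<exists>xs :: 'a list. n = list_encode (map code xs)" if "ind (\<lambda>n. n = 0) R n" for n
    using that
  proof induction
    case (base n)
    then show ?case by (intro exI[of _ "[]"]) simp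
  next
    case (step y z n)
    then obtain xs :: "'a list" and x :: 'a
      where "y = list_encode (map code xs)" "n = Suc (prod_encode (code x, y))"
      unfolding R_def by blast
    then show ?case by (intro exI[of _ "x # xs"]) simp
  qed
  ultimately have *: "n \<in> range (code :: 'a list \<Rightarrow> nat) \<longleftrightarrow> ind (\<lambda>n. n = 0) R n" for n
    unfolding code_list_def image_iff by blast
  have "arith_pred (ind (\<lambda>n. n = 0) R)"
    by (rule arith_pred_ind; unfold arith_pred_def R_def; intro arith_intros)
  then show "arith (\<lambda>e. e 0 \<in> range (code :: 'a list \<Rightarrow> nat))"
    unfolding * by (rule arith_app[OF _ arithf_var])
qed

end

lemma arithf_Cons [arith_intros]:
  "arithf F \<Longrightarrow> arithf G \<Longrightarrow> arithf (\<lambda>e. F e # G e)"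
  using arithf_Suc[OF arithf_prod_encode[OF arithf_code arithf_code, of F G]]
  by (simp add: arithf_def code_nat_def code_list_def)


section \<open>Recursive functions\<close>

text \<open>The index is fixed, as in \<open>RProj i\<close>, so there is one formula for each
  \<open>i\<close>, found by induction outside arithmetic.\<close>

lemma arith_pred_nth: "arith_pred (\<lambda>(xs::nat list, y). i < length xs \<and> y = xs ! i)"
proof (induction i)
  case 0
  have *: "0 < length xs \<and> y = xs ! 0 \<longleftrightarrow> (\<exists>zs. xs = y # zs)" for xs and y :: nat
    by (cases xs) auto
  show ?case unfolding arith_pred_def * by (intro arith_intros)
next
  case (Suc i)
  have *: "Suc i < length xs \<and> y = xs ! Suc i \<longleftrightarrow>
      (\<exists>z zs. xs = z # zs \<and> i < length zs \<and> y = zs ! i)"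
    for xs and y :: nat
    by (cases xs) auto
  show ?case unfolding arith_pred_def * by (intro arith_intros arith_app2[OF Suc])
qed

lemma arith_pred_list_all2:
  assumes "\<And>g. g \<in> set gs \<Longrightarrow> arith_pred (\<lambda>(xs, y). reval g xs y)"
  shows "arith_pred (\<lambda>(xs, ys). list_all2 (\<lambda>g y. reval g xs y) gs ys)"
  using assms
proof (induction gs)
  case Nil
  show ?case unfolding arith_pred_def list_all2_Nil by (intro arith_intros)
next
  case (Cons g gs)
  then have g: "arith_pred (\<lambda>(xs, y). reval g xs y)"
    and gs: "arith_pred (\<lambda>(xs, ys). list_all2 (\<lambda>g y. reval g xs y) gs ys)" by auto
  have *: "list_all2 (\<lambda>g y. reval g xs y) (g # gs) zs \<longleftrightarrow>
    (\<exists>y ys. zs = y # ys \<and> reval g xs y \<and>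
      list_all2 (\<lambda>g y. reval g xs y) gs ys)" for xs zs
    by (cases zs) auto
  show ?case unfolding arith_pred_def *
    by (intro arith_intros arith_app2[OF g] arith_app2[OF gs])
qed

text \<open>Induction on the program, with one formula for each \<open>f\<close>; only arguments and
  values are coded. Composition and minimization reduce to quantifiers, and primitive recursion to a
  generated set.\<close>

lemma arith_pred_reval: "arith_pred (\<lambda>(xs, y). reval f xs y)"
proof (induction f)
  case RZero
  have *: "reval RZero xs y \<longleftrightarrow> y = 0" for xs y
    by (auto intro: reval.intros elim: reval_elims)
  show ?case unfolding arith_pred_def * by (intro arith_intros)
next
  case RSucc
  have *: "reval RSucc xs y \<longleftrightarrow> (\<exists>x. xs = [x] \<and> y = Suc x)" for xs y
    by (auto intro: reval.intros elim: reval_elims)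
  show ?case unfolding arith_pred_def * by (intro arith_intros)
next
  case (RProj i)
  have *: "reval (RProj i) xs y \<longleftrightarrow> i < length xs \<and> y = xs ! i" for xs y
    by (auto intro: reval.intros elim: reval_elims)
  show ?case unfolding * by (rule arith_pred_nth)
next
  case (RComp f gs)
  note gs = arith_pred_list_all2[OF RComp(2)]
  have *: "reval (RComp f gs) xs z \<longleftrightarrow>
      (\<exists>ys. list_all2 (\<lambda>g y. reval g xs y) gs ys \<and>
        reval f ys z)" for xs z
    by (auto intro: reval.intros elim: reval_elims)
  show ?case unfolding arith_pred_def *
    by (intro arith_intros arith_app2[OF RComp(1)] arith_app2[OF gs])
next
  case (RPrim f g)
  \<comment> \<open>Pairs of argument list and value: \<open>A\<close> contains those with recursion
    argument 0, and \<open>R\<close> raises the recursion argument by one.\<close>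
  define A where "A = (\<lambda>p. \<exists>xs y. p = (0 # xs, y) \<and> reval f xs y)"
  define R where "R = (\<lambda>p p' :: nat list \<times> nat. \<lambda>q. \<exists>n xs y z.
    p = (n # xs, y) \<and> q = (Suc n # xs, z) \<and> reval g (n # y # xs) z)"
  \<comment> \<open>The program is generalized to \<open>f'\<close> for the induction over
    \<open>reval\<close>; the equation then rules out every case except primitive recursion.\<close>
  have 1: "reval f' xs y \<Longrightarrow> f' = RPrim f g \<Longrightarrow> ind A R (xs, y)" for f' xs y
  proof (induction rule: reval.induct)
    case (prim_0 f' xs y g')
    then have "f' = f" by simp
    with prim_0.hyps have "A (0 # xs, y)" by (simp add: A_def)
    then show ?case by (rule ind.base)
  next
    case (prim_Suc f' g' n xs y z)
    then have *: "f' = f" "g' = g" by simp_all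
    have "ind A R (n # xs, y)" using prim_Suc.IH(1) * by blast
    moreover have "R (n # xs, y) (n # xs, y) (Suc n # xs, z)"
      using prim_Suc.hyps * by (simp add: R_def)
    ultimately show ?case by (blast intro: ind.step)
  qed simp_all
  have 2: "ind A R p \<Longrightarrow> case p of (xs, y) \<Rightarrow> reval (RPrim f g) xs y" for p
    by (induction rule: ind.induct) (auto simp: A_def R_def intro: reval.intros)
  have "(\<lambda>(xs, y). reval (RPrim f g) xs y) = ind A R"
    using 1 2 by fastforce
  moreover have "arith_pred A" unfolding arith_pred_def A_def
    by (intro arith_intros arith_app2[OF RPrim(1)])
  moreover have "arith_pred (\<lambda>(y, z, x). R y z x)" unfolding arith_pred_def R_def
    by (intro arith_intros arith_app2[OF RPrim(2)])
  ultimately show ?case by (simp add: arith_pred_ind)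
next
  case (RMu f)
  have *: "reval (RMu f) xs n \<longleftrightarrow> reval f (n # xs) 0 \<and>
      (\<forall>m. m < n \<longrightarrow> (\<exists>k. reval f (m # xs) (Suc k)))" for xs n
    by (auto intro: reval.intros elim: reval_elims)
  show ?case unfolding arith_pred_def *
    by (intro arith_intros arith_app2[OF RMu])
qed


section \<open>Syntax\<close>

instantiation tm :: coded
begin

definition code_tm :: "tm \<Rightarrow> nat" where "code_tm = gn_tm"

instance
proof
  show "inj (code :: tm \<Rightarrow> nat)" by (simp add: inj_def code_tm_def gn_tm_inject)
  \<comment> \<open>\<open>A\<close> gives the codes of atomic terms and \<open>R\<close> those of
    compound terms; together they generate the range of \<open>gn_tm\<close>.\<close>
  define A where "A = (\<lambda>n. (\<exists>i. n = prod_encode (0, i)) \<or> n = prod_encode (1, 0))"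
  define R where "R = (\<lambda>y z n. n = prod_encode (2, y) \<or> n = prod_encode (3, prod_encode (y, z)) \<or>
    n = prod_encode (4, prod_encode (y, z)))"
  have "ind A R (gn_tm t)" for t
  proof (induction t)
    case (Var i)
    show ?case by (rule ind.base) (simp add: A_def)
  next
    case Zero
    show ?case by (rule ind.base) (simp add: A_def)
  next
    case (Succ t)
    show ?case by (rule ind.step[OF Succ Succ]) (simp add: R_def)
  next
    case (Add t u)
    show ?case by (rule ind.step[OF Add]) (simp add: R_def)
  next
    case (Mul t u)
    show ?case by (rule ind.step[OF Mul]) (simp add: R_def)
  qed
  moreover have "n \<in> range gn_tm" if "ind A R n" for n
    using that
  proof induction
    case (base n)
    then have "(\<exists>i. n = gn_tm (Var i)) \<or> n = gn_tm Zero" by (simp add: A_def)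
    then show ?case by blast
  next
    case (step y z n)
    then obtain t u where "y = gn_tm t" "z = gn_tm u" by blast
    with step.hyps(3) have "n = gn_tm (Succ t) \<or> n = gn_tm (Add t u) \<or> n = gn_tm (Mul t u)"
      by (simp add: R_def)
    then show ?case by blast
  qed
  ultimately have *: "n \<in> range (code :: tm \<Rightarrow> nat) \<longleftrightarrow> ind A R n" for n
    unfolding code_tm_def by blast
  have "arith_pred (ind A R)"
    by (rule arith_pred_ind; unfold arith_pred_def A_def R_def; intro arith_intros)
  then show "arith (\<lambda>e. e 0 \<in> range (code :: tm \<Rightarrow> nat))"
    unfolding * by (rule arith_app[OF _ arithf_var])
qed

end

text \<open>Passing to codes turns the syntactic constructors into pairings of numbers.\<close>

lemma arithf_iff_code: "arithf F \<longleftrightarrow> arithf (\<lambda>e. code (F e))"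
  by (simp add: arithf_def code_nat_def)

lemma arithf_tm [arith_intros]:
  "arithf I \<Longrightarrow> arithf (\<lambda>e. Var (I e))"
  "arithf F \<Longrightarrow> arithf (\<lambda>e. Succ (F e))"
  "arithf F \<Longrightarrow> arithf G \<Longrightarrow> arithf (\<lambda>e. Add (F e) (G e))"
  "arithf F \<Longrightarrow> arithf G \<Longrightarrow> arithf (\<lambda>e. Mul (F e) (G e))"
  unfolding arithf_iff_code[where 'a = tm] code_tm_def gn_tm.simps
  by (intro arith_intros; assumption)+

instantiation fm :: coded
begin

definition code_fm :: "fm \<Rightarrow> nat" where "code_fm = gn"

instance
proof
  show "inj (code :: fm \<Rightarrow> nat)" by (simp add: inj_def code_fm_def gn_inject)
  define A where "A = (\<lambda>n. \<exists>(t::tm) (u::tm). n = prod_encode (0, prod_encode (code t, code u)) \<or>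
    n = prod_encode (1, prod_encode (code t, code u)))"
  define R where "R = (\<lambda>y z n. n = prod_encode (2, y) \<or> n = prod_encode (3, prod_encode (y, z)) \<or>
    (\<exists>x. n = prod_encode (4, prod_encode (x, y))))"
  have "ind A R (gn \<phi>)" for \<phi>
  proof (induction \<phi>)
    case (Eq t u)
    show ?case by (rule ind.base) (auto simp: A_def code_tm_def)
  next
    case (Le t u)
    show ?case by (rule ind.base) (auto simp: A_def code_tm_def)
  next
    case (Neg \<phi>)
    show ?case by (rule ind.step[OF Neg Neg]) (simp add: R_def)
  next
    case (Imp \<phi> \<psi>)
    show ?case by (rule ind.step[OF Imp]) (simp add: R_def)
  next
    case (All x \<phi>)
    show ?case by (rule ind.step[OF All All]) (simp add: R_def)
  qed
  moreover have "n \<in> range gn" if "ind A R n" for n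
    using that
  proof induction
    case (base n)
    then have "\<exists>t u. n = gn (Eq t u) \<or> n = gn (Le t u)" by (simp add: A_def code_tm_def)
    then show ?case by blast
  next
    case (step y z n)
    then obtain \<phi> \<psi> where "y = gn \<phi>" "z = gn \<psi>" by blast
    with step.hyps(3) have "n = gn (Neg \<phi>) \<or> n = gn (Imp \<phi> \<psi>) \<or> (\<exists>x. n = gn (All x \<phi>))"
      by (simp add: R_def)
    then show ?case by blast
  qed
  ultimately have *: "n \<in> range (code :: fm \<Rightarrow> nat) \<longleftrightarrow> ind A R n" for n
    unfolding code_fm_def by blast
  have "arith_pred (ind A R)"
    by (rule arith_pred_ind; unfold arith_pred_def A_def R_def; intro arith_intros)
  then show "arith (\<lambda>e. e 0 \<in> range (code :: fm \<Rightarrow> nat))"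
    unfolding * by (rule arith_app[OF _ arithf_var])
qed

end

lemma arithf_fm [arith_intros]:
  "arithf S \<Longrightarrow> arithf T \<Longrightarrow> arithf (\<lambda>e. Eq (S e) (T e))"
  "arithf S \<Longrightarrow> arithf T \<Longrightarrow> arithf (\<lambda>e. Le (S e) (T e))"
  "arithf F \<Longrightarrow> arithf (\<lambda>e. Neg (F e))"
  "arithf F \<Longrightarrow> arithf G \<Longrightarrow> arithf (\<lambda>e. Imp (F e) (G e))"
  "arithf I \<Longrightarrow> arithf F \<Longrightarrow> arithf (\<lambda>e. All (I e) (F e))"
  unfolding arithf_iff_code[where 'a = tm] arithf_iff_code[where 'a = fm]
    code_tm_def code_fm_def gn.simps
  by (intro arith_intros; assumption)+

section \<open>Structural recursions on terms and formulas\<close>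

lemma arith_pred_fv_tm: "arith_pred (\<lambda>(i, t). i \<in> fv_tm t)"
proof -
  define A where "A = (\<lambda>p. \<exists>i. p = (i, Var i))"
  \<comment> \<open>A variable occurs in a compound term through one subterm. The clause
    \<open>q = p\<close> repeats this premise, so the measure decreases for both.\<close>
  define R where "R = (\<lambda>p q :: nat \<times> tm. \<lambda>r. \<exists>i t u. p = (i, t) \<and> (r = (i, Succ t) \<or>
    r = (i, Add t u) \<or> r = (i, Add u t) \<or> r = (i, Mul t u) \<or> r = (i, Mul u t)) \<and> q = p)"
  show ?thesis
  proof (rule arith_pred_rec)
    show "arith_pred A" "arith_pred (\<lambda>(p, q, r). R p q r)"
      unfolding arith_pred_def A_def R_def by (intro arith_intros)+
    show "size (snd p) < size (snd r) \<and> size (snd q) < size (snd r)" if "R p q r" for p q r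
      using that by (auto simp: R_def)
    show "(case p of (i, t) \<Rightarrow> i \<in> fv_tm t) \<longleftrightarrow> A p \<or>
      (\<exists>q r. (case q of (i, t) \<Rightarrow> i \<in> fv_tm t) \<and> (case r of (i, t) \<Rightarrow> i \<in> fv_tm t) \<and> R q r p)" for p
    proof (cases p)
      case (Pair i t)
      then show ?thesis by (cases t) (auto simp: A_def R_def)
    qed
  qed
qed

lemma arith_pred_fv: "arith_pred (\<lambda>(i, \<phi>). i \<in> fv \<phi>)"
proof -
  define A where "A = (\<lambda>p. \<exists>i t u. (i \<in> fv_tm t \<or> i \<in> fv_tm u) \<and> (p = (i, Eq t u) \<or> p = (i, Le t u)))"
  define R where "R = (\<lambda>p q :: nat \<times> fm. \<lambda>r. \<exists>i \<phi> \<psi> x. p = (i, \<phi>) \<and> (r = (i, Neg \<phi>) \<or>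
    r = (i, Imp \<phi> \<psi>) \<or> r = (i, Imp \<psi> \<phi>) \<or> r = (i, All x \<phi>) \<and> i \<noteq> x) \<and> q = p)"
  show ?thesis
  proof (rule arith_pred_rec)
    show "arith_pred A" "arith_pred (\<lambda>(p, q, r). R p q r)"
      unfolding arith_pred_def A_def R_def by (intro arith_intros arith_app2[OF arith_pred_fv_tm])+
    show "size (snd p) < size (snd r) \<and> size (snd q) < size (snd r)" if "R p q r" for p q r
      using that by (auto simp: R_def)
    show "(case p of (i, \<phi>) \<Rightarrow> i \<in> fv \<phi>) \<longleftrightarrow> A p \<or>
      (\<exists>q r. (case q of (i, \<phi>) \<Rightarrow> i \<in> fv \<phi>) \<and> (case r of (i, \<phi>) \<Rightarrow> i \<in> fv \<phi>) \<and> R q r p)" for p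
    proof (cases p)
      case (Pair i \<phi>)
      then show ?thesis by (cases \<phi>) (auto simp: A_def R_def)
    qed
  qed
qed

text \<open>The graph is generated as a set of quadruples, with \<open>x\<close> and
  \<open>s\<close> carried along unchanged so that both subterms use the same substitution.\<close>

lemma arith_pred_subst_tm: "arith_pred (\<lambda>(x, s, t, u). subst_tm t x s = u)"
proof -
  define A where "A = (\<lambda>p. \<exists>(x::nat) s i. p = (x, s, Var x, s) \<or> i \<noteq> x \<and> p = (x, s, Var i, Var i) \<or>
    p = (x, s, Zero, Zero))"
  define R where "R = (\<lambda>p q r. \<exists>(x::nat) (s::tm) t u t' u'. p = (x, s, t, u) \<and> q = (x, s, t', u') \<and>
    (r = (x, s, Succ t, Succ u) \<and> q = p \<or> r = (x, s, Add t t', Add u u') \<or> r = (x, s, Mul t t', Mul u u')))"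
  show ?thesis
  proof (rule arith_pred_rec)
    show "arith_pred A" "arith_pred (\<lambda>(p, q, r). R p q r)"
      unfolding arith_pred_def A_def R_def by (intro arith_intros)+
    show "size (fst (snd (snd p))) < size (fst (snd (snd r))) \<and>
        size (fst (snd (snd q))) < size (fst (snd (snd r)))" if "R p q r" for p q r
      using that by (auto simp: R_def)
    show "(case p of (x, s, t, u) \<Rightarrow> subst_tm t x s = u) \<longleftrightarrow> A p \<or>
      (\<exists>q r. (case q of (x, s, t, u) \<Rightarrow> subst_tm t x s = u) \<and>
        (case r of (x, s, t, u) \<Rightarrow> subst_tm t x s = u) \<and> R q r p)" for p
    proof (cases p)
      case (fields x s t u)
      then show ?thesis by (cases t) (auto simp: A_def R_def)
    qed
  qed
qed

lemma arithf_subst_tm [arith_intros]: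
  assumes "arithf F" "arithf I" "arithf S"
  shows "arithf (\<lambda>e. subst_tm (F e) (I e) (S e))"
proof (rule arithfI)
  show "arith (\<lambda>e. decode (e 0) = subst_tm (F (\<lambda>i. e (Suc i))) (I (\<lambda>i. e (Suc i))) (S (\<lambda>i. e (Suc i))))"
    unfolding eq_commute[of "decode _"]
    using arith_app[OF arith_pred_subst_tm arithf_Pair[OF arithf_shift[OF assms(2)]
        arithf_Pair[OF arithf_shift[OF assms(3)] arithf_Pair[OF arithf_shift[OF assms(1)] arithf_decode[of 0]]]]]
    by simp
qed

lemma arith_pred_subst: "arith_pred (\<lambda>(x, s, \<phi>, \<psi>). subst \<phi> x s = \<psi>)"
proof -
  \<comment> \<open>A quantifier that binds \<open>x\<close> stops the substitution and is therefore
    a base case.\<close>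
  define A where "A = (\<lambda>p. \<exists>x s t u \<phi>.
    p = (x, s, Eq t u, Eq (subst_tm t x s) (subst_tm u x s)) \<or>
    p = (x, s, Le t u, Le (subst_tm t x s) (subst_tm u x s)) \<or>
    p = (x, s, All x \<phi>, All x \<phi>))"
  define R where "R = (\<lambda>p q r. \<exists>x (s::tm) \<phi> \<psi> \<phi>' \<psi>' y. p = (x, s, \<phi>, \<psi>) \<and> q = (x, s, \<phi>', \<psi>') \<and>
    (r = (x, s, Neg \<phi>, Neg \<psi>) \<and> q = p \<or> r = (x, s, Imp \<phi> \<phi>', Imp \<psi> \<psi>') \<or>
      y \<noteq> x \<and> r = (x, s, All y \<phi>, All y \<psi>) \<and> q = p))"
  show ?thesis
  proof (rule arith_pred_rec)
    show "arith_pred A" "arith_pred (\<lambda>(p, q, r). R p q r)"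
      unfolding arith_pred_def A_def R_def by (intro arith_intros)+
    show "size (fst (snd (snd p))) < size (fst (snd (snd r))) \<and>
        size (fst (snd (snd q))) < size (fst (snd (snd r)))" if "R p q r" for p q r
      using that by (auto simp: R_def)
    show "(case p of (x, s, \<phi>, \<psi>) \<Rightarrow> subst \<phi> x s = \<psi>) \<longleftrightarrow> A p \<or>
      (\<exists>q r. (case q of (x, s, \<phi>, \<psi>) \<Rightarrow> subst \<phi> x s = \<psi>) \<and>
        (case r of (x, s, \<phi>, \<psi>) \<Rightarrow> subst \<phi> x s = \<psi>) \<and> R q r p)" for p
    proof (cases p)
      case (fields x s \<phi> \<psi>)
      then show ?thesis by (cases \<phi>) (auto simp: A_def R_def)
    qed
  qed
qed

lemma arithf_subst [arith_intros]:
  assumes "arithf F" "arithf I" "arithf S"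
  shows "arithf (\<lambda>e. subst (F e) (I e) (S e))"
proof (rule arithfI)
  show "arith (\<lambda>e. decode (e 0) = subst (F (\<lambda>i. e (Suc i))) (I (\<lambda>i. e (Suc i))) (S (\<lambda>i. e (Suc i))))"
    unfolding eq_commute[of "decode _"]
    using arith_app[OF arith_pred_subst arithf_Pair[OF arithf_shift[OF assms(2)]
        arithf_Pair[OF arithf_shift[OF assms(3)] arithf_Pair[OF arithf_shift[OF assms(1)] arithf_decode[of 0]]]]]
    by simp
qed

lemma arith_pred_free_for: "arith_pred (\<lambda>(s, x, \<phi>). free_for s x \<phi>)"
proof -
  \<comment> \<open>The disjunction in the \<open>All\<close> clause of \<open>free_for\<close> is
    split: the alternative where \<open>x\<close> is not free is a base case, the other one goes
    through \<open>R\<close>.\<close>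
  define A where "A = (\<lambda>p. \<exists>(s::tm) x t u y \<phi>. p = (s, x, Eq t u) \<or> p = (s, x, Le t u) \<or>
    x \<notin> fv (All y \<phi>) \<and> p = (s, x, All y \<phi>))"
  define R where "R = (\<lambda>p q r. \<exists>s (x::nat) \<phi> \<psi> y. p = (s, x, \<phi>) \<and> q = (s, x, \<psi>) \<and>
    (r = (s, x, Neg \<phi>) \<and> q = p \<or> r = (s, x, Imp \<phi> \<psi>) \<or> y \<notin> fv_tm s \<and> r = (s, x, All y \<phi>) \<and> q = p))"
  show ?thesis
  proof (rule arith_pred_rec)
    show "arith_pred A" "arith_pred (\<lambda>(p, q, r). R p q r)"
      unfolding arith_pred_def A_def R_def
      by (intro arith_intros arith_app2[OF arith_pred_fv] arith_app2[OF arith_pred_fv_tm])+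
    show "size (snd (snd p)) < size (snd (snd r)) \<and> size (snd (snd q)) < size (snd (snd r))"
      if "R p q r" for p q r
      using that by (auto simp: R_def)
    show "(case p of (s, x, \<phi>) \<Rightarrow> free_for s x \<phi>) \<longleftrightarrow> A p \<or>
      (\<exists>q r. (case q of (s, x, \<phi>) \<Rightarrow> free_for s x \<phi>) \<and>
        (case r of (s, x, \<phi>) \<Rightarrow> free_for s x \<phi>) \<and> R q r p)" for p
    proof (cases p)
      case (fields s x \<phi>)
      then show ?thesis by (cases \<phi>) (auto simp: A_def R_def)
    qed
  qed
qed

text \<open>Needed for the diagonal sentence, which contains the numeral of a code. The recursion is
  on the number, which serves as its own measure.\<close>

lemma arithf_num [arith_intros]:
  assumes "arithf F"
  shows "arithf (\<lambda>e. num (F e))"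
proof (rule arithfI)
  define A where "A = (\<lambda>p. p = (0 :: nat, Zero))"
  define R where "R = (\<lambda>p q :: nat \<times> tm. \<lambda>r. \<exists>n t. p = (n, t) \<and> r = (Suc n, Succ t) \<and> q = p)"
  have *: "arith_pred (\<lambda>(n, t). num n = t)"
  proof (rule arith_pred_rec)
    show "arith_pred A" "arith_pred (\<lambda>(p, q, r). R p q r)"
      unfolding arith_pred_def A_def R_def by (intro arith_intros)+
    show "fst p < fst r \<and> fst q < fst r" if "R p q r" for p q r
      using that by (auto simp: R_def)
    show "(case p of (n, t) \<Rightarrow> num n = t) \<longleftrightarrow> A p \<or>
      (\<exists>q r. (case q of (n, t) \<Rightarrow> num n = t) \<and> (case r of (n, t) \<Rightarrow> num n = t) \<and> R q r p)" for p
    proof (cases p)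
      case (Pair n t)
      then show ?thesis by (cases n) (auto simp: A_def R_def)
    qed
  qed
  show "arith (\<lambda>e. decode (e 0) = num (F (\<lambda>i. e (Suc i))))"
    unfolding eq_commute[of "decode _"]
    by (rule arith_app2[OF * arithf_shift[OF assms] arithf_decode])
qed


section \<open>Provability\<close>

text \<open>The axioms are split off from the rules: this predicate is not recursive, so its
  \<open>simps\<close> equation describes it explicitly by existential quantifiers.\<close>

inductive logical_axiom :: "fm \<Rightarrow> bool" where
  K: "logical_axiom (Imp \<phi> (Imp \<psi> \<phi>))"
| S: "logical_axiom (Imp (Imp \<phi> (Imp \<psi> \<chi>)) (Imp (Imp \<phi> \<psi>) (Imp \<phi> \<chi>)))"
| Contra: "logical_axiom (Imp (Imp (Neg \<psi>) (Neg \<phi>)) (Imp (Imp (Neg \<psi>) \<phi>) \<psi>))"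
| Inst: "free_for t x \<phi> \<Longrightarrow> logical_axiom (Imp (All x \<phi>) (subst \<phi> x t))"
| All_Imp: "x \<notin> fv \<phi> \<Longrightarrow> logical_axiom (Imp (All x (Imp \<phi> \<psi>)) (Imp \<phi> (All x \<psi>)))"
| Refl: "logical_axiom (Eq t t)"
| Leibniz: "free_for t x \<phi> \<Longrightarrow> free_for u x \<phi> \<Longrightarrow>
    logical_axiom (Imp (Eq t u) (Imp (subst \<phi> x t) (subst \<phi> x u)))"

lemma prv_logical_axiom: "logical_axiom \<phi> \<Longrightarrow> T \<turnstile> \<phi>"
  by (induction rule: logical_axiom.induct) (rule prv.intros; assumption)+

lemma arith_pred_logical_axiom: "arith_pred logical_axiom"
  unfolding arith_pred_def logical_axiom.simps
  by (intro arith_intros arith_app2[OF arith_pred_fv] arith_app3[OF arith_pred_free_for])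

text \<open>Modus ponens and generalization merged into one ternary rule, the shape that
  \<open>ind\<close> requires.\<close>

definition inference :: "fm \<Rightarrow> fm \<Rightarrow> fm \<Rightarrow> bool" where
  "inference \<phi> \<psi> \<chi> \<longleftrightarrow> \<phi> = Imp \<psi> \<chi> \<or> (\<exists>x. \<chi> = All x \<phi>)"

lemma arith_pred_inference: "arith_pred (\<lambda>(\<phi>, \<psi>, \<chi>). inference \<phi> \<psi> \<chi>)"
  unfolding arith_pred_def inference_def by (intro arith_intros)

lemma prv_iff_ind: "T \<turnstile> \<phi> \<longleftrightarrow> ind (\<lambda>\<alpha>. \<alpha> \<in> T \<or> logical_axiom \<alpha>) inference \<phi>"
proof
  have ax: "logical_axiom \<alpha> \<Longrightarrow> ind (\<lambda>\<alpha>. \<alpha> \<in> T \<or> logical_axiom \<alpha>) inference \<alpha>" for \<alpha>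
    by (rule ind.base) simp
  assume "T \<turnstile> \<phi>"
  then show "ind (\<lambda>\<alpha>. \<alpha> \<in> T \<or> logical_axiom \<alpha>) inference \<phi>"
  proof induction
    case (Hyp \<phi>)
    then show ?case by (intro ind.base) simp
  next
    case (MP \<phi> \<psi>)
    show ?case by (rule ind.step[OF MP.IH]) (simp add: inference_def)
  next
    case (Gen \<phi> x)
    show ?case by (rule ind.step[OF Gen.IH Gen.IH]) (simp add: inference_def)
  qed (rule ax, erule logical_axiom.intros | rule ax, rule logical_axiom.intros; assumption)+
next
  assume "ind (\<lambda>\<alpha>. \<alpha> \<in> T \<or> logical_axiom \<alpha>) inference \<phi>"
  then show "T \<turnstile> \<phi>"
  proof induction
    case (base \<phi>)
    then show ?case
    proof
      assume "logical_axiom \<phi>"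
      then show ?thesis by (rule prv_logical_axiom)
    qed (rule prv.Hyp)
  next
    case (step \<phi> \<psi> \<chi>)
    then consider "\<phi> = Imp \<psi> \<chi>" | x where "\<chi> = All x \<phi>" unfolding inference_def by blast
    then show ?case
    proof cases
      case 1
      then show ?thesis using step.IH prv.MP by simp
    next
      case 2
      then show ?thesis using step.IH(1) prv.Gen by simp
    qed
  qed
qed

lemma arith_pred_prv:
  assumes "arith_pred (\<lambda>\<alpha>. \<alpha> \<in> T)"
  shows "arith_pred (prv T)"
proof -
  have "arith_pred (\<lambda>\<alpha>. \<alpha> \<in> T \<or> logical_axiom \<alpha>)"
    unfolding arith_pred_def
    by (intro arith_intros arith_app[OF assms] arith_app[OF arith_pred_logical_axiom])
  then have "arith_pred (ind (\<lambda>\<alpha>. \<alpha> \<in> T \<or> logical_axiom \<alpha>) inference)"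
    using arith_pred_inference by (rule arith_pred_ind)
  moreover have "prv T = ind (\<lambda>\<alpha>. \<alpha> \<in> T \<or> logical_axiom \<alpha>) inference"
    by (intro ext prv_iff_ind)
  ultimately show ?thesis by (simp only:)
qed

text \<open>The members of \<open>T'\<close> are recognized by an arithmetical \<open>reval\<close>,
  so provability from \<open>T'\<close> is arithmetical; on sentences it agrees with provability
  from \<open>T\<close>.\<close>

lemma definable_Pr:
  assumes "recursively_axiomatizable T"
  shows "definable (Pr T)"
proof -
  obtain T' where rec: "recursive_set (gn ` T')"
    and T': "\<And>\<sigma>. sentence \<sigma> \<Longrightarrow> T \<turnstile> \<sigma> \<longleftrightarrow> T' \<turnstile> \<sigma>"
    using assms unfolding recursively_axiomatizable_def by blast
  obtain f where f: "\<And>n. reval f [n] (if n \<in> gn ` T' then 1 else 0)"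
    using rec unfolding recursive_set_def by blast
  \<comment> \<open>Testing for the value 1 is enough: off \<open>T'\<close> the value is 0, and
    values are unique.\<close>
  have *: "\<alpha> \<in> T' \<longleftrightarrow> reval f [code \<alpha>] 1" for \<alpha>
  proof (cases "\<alpha> \<in> T'")
    case True
    then show ?thesis using f[of "code \<alpha>"] by (simp add: code_fm_def)
  next
    case False
    then have "code \<alpha> \<notin> gn ` T'" by (auto simp: code_fm_def gn_inject)
    then have "reval f [code \<alpha>] 0" using f[of "code \<alpha>"] by (simp only: if_False)
    then have "\<not> reval f [code \<alpha>] 1" using reval_functional by fastforce
    then show ?thesis using False by blast
  qed
  have "arith_pred (\<lambda>\<alpha>. \<alpha> \<in> T')"
    unfolding arith_pred_def * by (intro arith_intros arith_app2[OF arith_pred_reval])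
  note prv = arith_app[OF arith_pred_prv[OF this]]
  have **: "n \<in> Pr T \<longleftrightarrow> (\<exists>\<sigma>. n = code \<sigma> \<and> (\<forall>i. i \<notin> fv \<sigma>) \<and> T' \<turnstile> \<sigma>)" for n
    unfolding Pr_def code_fm_def using T' by (auto simp: sentence_def)
  show ?thesis unfolding definable_iff_arith **
    by (intro arith_intros prv arith_app2[OF arith_pred_fv])
qed


section \<open>Undefinability of truth\<close>

text \<open>\<open>B\<close> collects the codes of formulas whose diagonal sentence is not a true
  sentence. If \<open>\<phi>\<close> defines \<open>B\<close>, then \<open>diag \<phi>\<close> says
  that the code of \<open>\<phi>\<close> lies in \<open>B\<close>, that is, that
  \<open>diag \<phi>\<close> is not true.\<close>

lemma truth_undefinable: "\<not> definable {gn \<sigma> | \<sigma>. sentence \<sigma> \<and> true_in_omega \<sigma>}"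
proof
  define Tr where "Tr = {gn \<sigma> | \<sigma>. sentence \<sigma> \<and> true_in_omega \<sigma>}"
  define diag where "diag \<phi> = All 0 (Imp (Eq (Var 0) (num (code \<phi>))) \<phi>)" for \<phi>
  define B where "B = {n. \<exists>\<phi>. n = code \<phi> \<and> code (diag \<phi>) \<notin> Tr}"
  assume "definable {gn \<sigma> | \<sigma>. sentence \<sigma> \<and> true_in_omega \<sigma>}"
  then have "arith_pred (\<lambda>n. n \<in> Tr)"
    unfolding definable_iff_arith Tr_def arith_pred_def decode_nat .
  note Tr = arith_app[OF this]
  have "arith (\<lambda>e. e 0 \<in> B)"
    unfolding B_def diag_def mem_Collect_eq by (intro arith_intros Tr)
  then obtain \<phi> where fv: "fv \<phi> \<subseteq> {0}" and \<phi>: "\<And>e. sat e \<phi> \<longleftrightarrow> e 0 \<in> B"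
    by (rule arith_imp_formula) blast
  have "sentence (diag \<phi>)" using fv by (auto simp: sentence_def diag_def)
  then have "code (diag \<phi>) \<in> Tr \<longleftrightarrow> true_in_omega (diag \<phi>)"
    by (auto simp: Tr_def code_fm_def gn_inject)
  also have "\<dots> \<longleftrightarrow> code \<phi> \<in> B" by (simp add: true_in_omega_def diag_def \<phi>)
  also have "\<dots> \<longleftrightarrow> code (diag \<phi>) \<notin> Tr" by (simp add: B_def)
  finally show False by simp
qed

theorem corollary1:
  fixes T :: "fm set"
  assumes "is_theory T"
  shows "(definable (Pr T) \<longrightarrow> sound T \<longrightarrow> incomplete T) \<and>
         (recursively_axiomatizable T \<longrightarrow> definable (Pr T))"
proof (intro conjI impI)
  assume "definable (Pr T)" "sound T"
  show "incomplete T"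
  proof (rule ccontr)
    assume "\<not> incomplete T"
    have "T \<turnstile> \<sigma> \<longleftrightarrow> true_in_omega \<sigma>" if "sentence \<sigma>" for \<sigma>
    proof
      assume "T \<turnstile> \<sigma>"
      then show "true_in_omega \<sigma>"
        using sat_prv[OF \<open>sound T\<close>] by (simp add: true_in_omega_def)
    next
      \<comment> \<open>Soundness excludes a proof of the negation, so completeness leaves a proof
        of the sentence itself.\<close>
      assume "true_in_omega \<sigma>"
      then have "\<not> T \<turnstile> Neg \<sigma>"
        using sat_prv[OF \<open>sound T\<close>, of "Neg \<sigma>"] by (auto simp: true_in_omega_def)
      then show "T \<turnstile> \<sigma>"
        using \<open>\<not> incomplete T\<close> that by (auto simp: incomplete_def)
    qed
    then have "Pr T = {gn \<sigma> | \<sigma>. sentence \<sigma> \<and> true_in_omega \<sigma>}" unfolding Pr_def by blast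
    then show False using \<open>definable (Pr T)\<close> truth_undefinable by simp
  qed
qed (rule definable_Pr)

end
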